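(* Let $f=h+\overline{g}$ be a locally univalent harmonic mapping in the unit disk $\mathbb{D}$. Then $\|S_f\|<\infty$ if and only if $\|Sh\|<\infty$.
   Context: $\mathbb{D}=\{z\in\mathbb{C}:|z|<1\}$. A harmonic mapping in $\mathbb{D}$ is a complex-valued harmonic function, written $f=h+\overline{g}$ with $h,g$ analytic in $\mathbb{D}$ (canonical representation, normalized by $g(0)=0$). It is locally univalent if and only if its Jacobian $J_f=|h'|^2-|g'|^2$ does not vanish in $\mathbb{D}$; it is then either sense-preserving ($J_f>0$ throughout $\mathbb{D}$) or sense-reversing ($J_f<0$ throughout $\mathbb{D}$), and $f$ is sense-preserving if and only if $\overline{f}$ is sense-reversing. If $f$ is sense-preserving, then $h'\neq 0$ and the dilatation $\omega=g'/h'$ is analytic with $|\omega|<1$, and the Schwarzian derivative of $f$ is $$S_f=Sh+\frac{\overline{\omega}}{1-|\omega|^2}\left(\frac{h''}{h'}\,\omega'-\omega''\right)-\frac32\left(\frac{\omega'\,\overline{\omega}}{1-|\omega|^2}\right)^2 ,$$ which equals $(\log J_f)_{zz}-\frac12\big((\log J_f)_z\big)^2$, with subscripts denoting $\partial/\partial z=\frac12(\partial/\partial x-i\,\partial/\partial y)$. If $f$ is sense-reversing, $S_f$ is defined by $S_f=S_{\overline{f}}$ (equivalently, by the same Jacobian formula with $|J_f|$ in place of $J_f$). Here $Sh=(h''/h')'-\frac12(h''/h')^2$ is the classical Schwarzian derivative of the analytic part $h$ of $f$. The Schwarzian norms are $\|S_f\|=\sup_{z\in\mathbb{D}}|S_f(z)|(1-|z|^2)^2$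 and $\|Sh\|=\sup_{z\in\mathbb{D}}|Sh(z)|(1-|z|^2)^2$.
   Formalization: For sense-reversing f, Sh is taken for the analytic part of the conjugate of f (that is, g up to a constant) instead of h; with h itself the claim is false, e.g. f = z²/4 + conj(z), where ‖S_f‖ is finite but Sh = -3/(2z²) is unbounded. *)

theory Defs
  imports "HOL-Complex_Analysis.Complex_Analysis"
begin

abbreviation unit_disc :: "complex set" where
  "unit_disc \<equiv> ball 0 1"

definition canonical_rep ::
  "(complex \<Rightarrow> complex) \<Rightarrow> (complex \<Rightarrow> complex) \<Rightarrow> (complex \<Rightarrow> complex) \<Rightarrow> bool" where
  "canonical_rep f h g \<longleftrightarrow>
     h holomorphic_on unit_disc \<and> g holomorphic_on unit_disc \<and> g 0 = 0 \<and>
     (\<forall>z\<in>unit_disc. f z = h z + cnj (g z))"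

definition locally_univalent_on :: "(complex \<Rightarrow> complex) \<Rightarrow> complex set \<Rightarrow> bool" where
  "locally_univalent_on f S \<longleftrightarrow>
     (\<forall>z\<in>S. \<exists>U. open U \<and> z \<in> U \<and> U \<subseteq> S \<and> inj_on f U)"

text \<open>
  Below, a harmonic mapping \<open>f = h + cnj g\<close> is passed as the pair \<open>h\<close>, \<open>g\<close>. On the unit disc
  \<open>f\<close> determines this pair, and only derivatives of \<open>h\<close> and \<open>g\<close> at points of the disc matter.
\<close>

definition jacobian :: "(complex \<Rightarrow> complex) \<Rightarrow> (complex \<Rightarrow> complex) \<Rightarrow> complex \<Rightarrow> real" where
  "jacobian h g z = (norm (deriv h z))\<^sup>2 - (norm (deriv g z))\<^sup>2"

definition sense_preserving :: "(complex \<Rightarrow> complex) \<Rightarrow> (complex \<Rightarrow> complex) \<Rightarrow> bool" where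
  "sense_preserving h g \<longleftrightarrow> (\<forall>z\<in>unit_disc. jacobian h g z > 0)"

definition dilatation :: "(complex \<Rightarrow> complex) \<Rightarrow> (complex \<Rightarrow> complex) \<Rightarrow> complex \<Rightarrow> complex" where
  "dilatation h g z = deriv g z / deriv h z"

definition schwarzian :: "(complex \<Rightarrow> complex) \<Rightarrow> complex \<Rightarrow> complex" where
  "schwarzian h z =
     deriv (\<lambda>w. deriv (deriv h) w / deriv h w) z - 1/2 * (deriv (deriv h) z / deriv h z)\<^sup>2"

definition sp_harmonic_schwarzian ::
  "(complex \<Rightarrow> complex) \<Rightarrow> (complex \<Rightarrow> complex) \<Rightarrow> complex \<Rightarrow> complex" where
  "sp_harmonic_schwarzian h g z =
     (let w = dilatation h g; d = complex_of_real (1 - (norm (w z))\<^sup>2) in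
        schwarzian h z
        + cnj (w z) / d * (deriv (deriv h) z / deriv h z * deriv w z - deriv (deriv w) z)
        - 3/2 * (deriv w z * cnj (w z) / d)\<^sup>2)"

text \<open>
  A locally univalent mapping that is not sense-preserving is sense-reversing, and its Schwarzian
  is that of the conjugate mapping \<open>g + cnj h\<close>. Renormalising that representation so that the
  coanalytic part vanishes at \<open>0\<close> changes both parts by constants only, which does not affect the
  derivatives.
\<close>

definition harmonic_schwarzian ::
  "(complex \<Rightarrow> complex) \<Rightarrow> (complex \<Rightarrow> complex) \<Rightarrow> complex \<Rightarrow> complex" where
  "harmonic_schwarzian h g =
     (if sense_preserving h g then sp_harmonic_schwarzian h g else sp_harmonic_schwarzian g h)"

definition schwarzian_norm :: "(complex \<Rightarrow> complex) \<Rightarrow> ennreal" where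
  "schwarzian_norm S = (SUP z\<in>unit_disc. ennreal (norm (S z) * (1 - (norm z)\<^sup>2)\<^sup>2))"

text \<open>
  The analytic part of whichever of \<open>f\<close> and its conjugate is sense-preserving. When \<open>f\<close> is
  sense-reversing, \<open>h\<close> itself is the wrong function to compare with: for
  \<open>f z = z^2/4 + cnj z\<close> the Schwarzian of \<open>f\<close> has finite norm while \<open>schwarzian h z = -3/(2*z^2)\<close>
  away from \<open>0\<close>.
\<close>

definition sp_analytic_part ::
  "(complex \<Rightarrow> complex) \<Rightarrow> (complex \<Rightarrow> complex) \<Rightarrow> complex \<Rightarrow> complex" where
  "sp_analytic_part h g = (if sense_preserving h g then h else g)"

end

theory Submission imports Defs begin

text \<open>
  Write \<open>w = g'/h'\<close>, \<open>P = h''/h'\<close> and \<open>k = w' cnj w / (1 - \<bar>w\<bar>\<^sup>2)\<close> for a sense-preserving mapping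
  \<open>h + cnj g\<close> with Jacobian \<open>J\<close>. The Schwarzians differ by an expression in \<open>P\<close>, \<open>w\<close>, \<open>w'\<close>, \<open>w''\<close>:
  \<open>S\<^sub>f - Sh = P k - w'' cnj w / (1 - \<bar>w\<bar>\<^sup>2) - 3/2 k\<^sup>2\<close>. As \<open>w\<close> maps the disc into itself,
  estimates of Schwarz--Pick type bound the terms in \<open>w'\<close> and \<open>w''\<close> by the right powers of
  \<open>1 / (1 - \<bar>z\<bar>)\<close>. Everything therefore reduces to showing that either Schwarzian being bounded
  forces \<open>P = O(1 / (1 - \<bar>z\<bar>))\<close>.

  Both implications come from the same Riccati argument. The function \<open>p = P\<close> satisfies
  \<open>p' = p\<^sup>2/2 + Sh\<close>. The function \<open>p = P - k = (log J)\<^sub>z\<close> is not holomorphic, but its \<open>z\<close>-derivative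
  is \<open>p\<^sup>2/2 + S\<^sub>f\<close> and its \<open>cnj z\<close>-derivative is \<open>- \<bar>w'\<bar>\<^sup>2 / (1 - \<bar>w\<bar>\<^sup>2)\<^sup>2 = O(1 / (1 - \<bar>z\<bar>)\<^sup>2)\<close>.
  In either case, in every direction \<open>v\<close> the derivative of \<open>p\<close> is \<open>p\<^sup>2/2 v\<close> up to an error
  \<open>O(\<bar>v\<bar> / (1 - \<bar>z\<bar>)\<^sup>2)\<close>. If \<open>\<bar>p\<bar> (1 - \<bar>z\<bar>)\<close> were very large somewhere, take a point where its
  analogue on a slightly smaller disc is maximal and rescale so that \<open>\<bar>p\<bar> = 1\<close> there. Then
  \<open>\<bar>p\<bar> \<le> 4/3\<close> on the unit disc about that point, and yet along a suitable radius \<open>p\<close> would follow the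
  solution \<open>1 / (1 - r/2)\<close> of \<open>q' = q\<^sup>2/2\<close> up to \<open>r = 1\<close>, where that solution has doubled
  (\<open>riccati_blow_up\<close> and \<open>riccati_disc_bound\<close>).

  Finally, a locally injective harmonic mapping has nonvanishing Jacobian, by Lewy's theorem
  (\<open>Lewy_jacobian_nonzero\<close>). Since the disc is connected, the Jacobian has constant sign, so
  either \<open>f\<close> or its conjugate is sense-preserving. Lewy's theorem is proved topologically: at a
  zero of the Jacobian some real linear functional of \<open>f\<close> has a critical point, so its level
  set contains at least four arcs that meet only there, and \<open>f\<close> would map their union injectively
  into a line (\<open>critical_level_set_not_injected\<close>).
\<close>

section \<open>Lewy's theorem\<close>

text \<open>
  The exponent \<open>n\<close> is the order of the first nonvanishing derivative of \<open>F\<close>. The factor \<open>a\<close> is \<open>0\<close>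
  when \<open>F\<close> is locally constant and \<open>1\<close> otherwise, which lets the level set argument below treat
  both situations at once.
\<close>

lemma holomorphic_critical_point_form:
  assumes hol: "F holomorphic_on S" and S: "open S" "\<xi> \<in> S" and crit: "deriv F \<xi> = 0"
  obtains n a \<phi> r where "2 \<le> n" "0 < r" "ball \<xi> r \<subseteq> S" "\<phi> holomorphic_on ball \<xi> r"
    "\<phi> \<xi> = 0" "deriv \<phi> \<xi> \<noteq> 0" "\<And>w. w \<in> ball \<xi> r \<Longrightarrow> F w = F \<xi> + a * \<phi> w ^ n"
proof (cases "\<forall>n>0. (deriv ^^ n) F \<xi> = 0")
  case True
  obtain r where r: "r > 0" "ball \<xi> r \<subseteq> S"
    using S openE by blast
  have const: "F w = F \<xi>" if "w \<in> ball \<xi> r" for w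
    using holomorphic_fun_eq_const_on_connected[of F "ball \<xi> r" \<xi> w]
      holomorphic_on_subset[OF hol r(2)] r(1) that True by auto
  show ?thesis
  proof (rule that[of 2 r "\<lambda>w. w - \<xi>" 0])
    show "F w = F \<xi> + 0 * (w - \<xi>)\<^sup>2" if "w \<in> ball \<xi> r" for w
      using const[OF that] by simp
  qed (use r in \<open>auto intro!: holomorphic_intros\<close>)
next
  case False
  define n where "n = (LEAST n. n > 0 \<and> (deriv ^^ n) F \<xi> \<noteq> 0)"
  have n: "n > 0" "(deriv ^^ n) F \<xi> \<noteq> 0"
    using LeastI_ex[of "\<lambda>n. n > 0 \<and> (deriv ^^ n) F \<xi> \<noteq> 0"] False unfolding n_def by auto
  have below: "(deriv ^^ i) F \<xi> = 0" if "0 < i" "i < n" for i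
    using not_less_Least[of i "\<lambda>n. n > 0 \<and> (deriv ^^ n) F \<xi> \<noteq> 0"] that unfolding n_def by auto
  have "n \<noteq> 1"
    using n crit by auto
  then have "2 \<le> n"
    using n by auto
  obtain g s where g: "0 < s" "g holomorphic_on ball \<xi> s"
      "\<And>w. w \<in> ball \<xi> s \<Longrightarrow> F w - F \<xi> = ((w - \<xi>) * g w) ^ n"
      "\<And>w. w \<in> ball \<xi> s \<Longrightarrow> g w \<noteq> 0"
    using holomorphic_factor_order_of_zero_strong[OF hol S n] below by (metis (no_types, lifting))
  obtain e where e: "e > 0" "ball \<xi> e \<subseteq> S"
    using S openE by blast
  define r where "r = min s e"
  have r: "r > 0" "ball \<xi> r \<subseteq> S" "ball \<xi> r \<subseteq> ball \<xi> s"
    using g e unfolding r_def by auto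
  have holg: "g holomorphic_on ball \<xi> r"
    using g(2) r(3) holomorphic_on_subset by blast
  have "(g has_field_derivative deriv g \<xi>) (at \<xi>)"
    using holomorphic_derivI[OF g(2)] g(1) by auto
  then have "((\<lambda>w. (w - \<xi>) * g w) has_field_derivative g \<xi>) (at \<xi>)"
    by (auto intro!: derivative_eq_intros)
  then have der: "deriv (\<lambda>w. (w - \<xi>) * g w) \<xi> = g \<xi>"
    by (rule DERIV_imp_deriv)
  show ?thesis
  proof (rule that[of n r "\<lambda>w. (w - \<xi>) * g w" 1])
    show "(\<lambda>w. (w - \<xi>) * g w) holomorphic_on ball \<xi> r"
      using holg by (intro holomorphic_intros)
    show "deriv (\<lambda>w. (w - \<xi>) * g w) \<xi> \<noteq> 0"
      using der g by simp
    show "F w = F \<xi> + 1 * ((w - \<xi>) * g w) ^ n" if "w \<in> ball \<xi> r" for w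
      using g(3)[of w] r(3) that by (auto simp: algebra_simps)
  qed (use r \<open>2 \<le> n\<close> in auto)
qed

text \<open>
  In the coordinate \<open>\<zeta> = \<phi> w\<close> the level set of \<open>Re F\<close> through \<open>\<xi>\<close> contains the rays on which
  \<open>a \<zeta>\<^sup>n\<close> is purely imaginary. There are at least \<open>2 n \<ge> 4\<close> of them, and three already suffice: a
  continuous real function \<open>v\<close> cannot be injective on their union: on two of the rays it moves to
  the same side of \<open>v \<xi>\<close>, so by the intermediate value theorem one ray attains the value that \<open>v\<close>
  has at the end of the other.
\<close>

lemma critical_level_set_not_injected:
  fixes v :: "complex \<Rightarrow> real"
  assumes hol: "F holomorphic_on S" and S: "open S" "\<xi> \<in> S" and crit: "deriv F \<xi> = 0"
    and cont: "continuous_on S v"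
  shows "\<exists>x\<in>S. \<exists>y\<in>S. x \<noteq> y \<and> Re (F x) = Re (F y) \<and> v x = v y"
proof -
  obtain n a \<phi> r where \<phi>: "2 \<le> n" "0 < r" "ball \<xi> r \<subseteq> S" "\<phi> holomorphic_on ball \<xi> r"
    "\<phi> \<xi> = 0" "deriv \<phi> \<xi> \<noteq> 0" "\<And>w. w \<in> ball \<xi> r \<Longrightarrow> F w = F \<xi> + a * \<phi> w ^ n"
    by (rule holomorphic_critical_point_form[OF hol S crit]; rule that)
  obtain s where s: "s > 0" "ball \<xi> s \<subseteq> ball \<xi> r" "open (\<phi> ` ball \<xi> s)" "inj_on \<phi> (ball \<xi> s)"
    using has_complex_derivative_locally_invertible[OF \<phi>(4) _ _ \<phi>(6)] \<phi>(2) by auto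
  have hols: "\<phi> holomorphic_on ball \<xi> s"
    using \<phi>(4) s(2) holomorphic_on_subset by blast
  obtain \<psi> where \<psi>: "\<psi> holomorphic_on \<phi> ` ball \<xi> s" "\<And>z. z \<in> ball \<xi> s \<Longrightarrow> \<psi> (\<phi> z) = z"
    using holomorphic_has_inverse[OF hols open_ball s(4)] by metis
  have "0 \<in> \<phi> ` ball \<xi> s"
    using \<phi>(5) s(1) by force
  then obtain \<rho> where \<rho>: "\<rho> > 0" "cball 0 \<rho> \<subseteq> \<phi> ` ball \<xi> s"
    using s(3) open_contains_cball by blast
  have \<psi>_in: "\<psi> \<zeta> \<in> ball \<xi> s" "\<phi> (\<psi> \<zeta>) = \<zeta>" if "\<zeta> \<in> cball 0 \<rho>" for \<zeta>
    using that \<rho>(2) \<psi>(2) by auto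
  have sub: "ball \<xi> s \<subseteq> S"
    using s(2) \<phi>(3) by blast
  \<comment> \<open>The rays are spanned by the \<open>n\<close>-th roots of \<open>\<plusminus> b / \<bar>b\<bar>\<close>; if \<open>a = 0\<close> any direction will do.\<close>
  define b where "b = (if a = 0 then 1 else \<i> / a)"
  have "b \<noteq> 0"
    by (simp add: b_def)
  define Z where "Z = {\<omega>::complex. \<omega> ^ n = b / norm b} \<union> {\<omega>. \<omega> ^ n = - (b / norm b)}"
  have Re0: "Re (a * \<omega> ^ n) = 0" if "\<omega> \<in> Z" for \<omega>
  proof (cases "a = 0")
    case False
    then have "a * (b / norm b) = \<i> / norm b"
      by (simp add: b_def)
    moreover have "\<omega> ^ n = b / norm b \<or> \<omega> ^ n = - (b / norm b)"
      using that by (auto simp: Z_def)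
    ultimately have "a * \<omega> ^ n = \<i> / norm b \<or> a * \<omega> ^ n = - (\<i> / norm b)"
      by (metis mult_minus_right)
    moreover have "Re (\<i> / norm b) = 0" "Re (- (\<i> / norm b)) = 0"
      by (simp_all add: Re_divide_of_real)
    ultimately show ?thesis
      by metis
  qed auto
  have norm1: "norm \<omega> = 1" if "\<omega> \<in> Z" for \<omega>
  proof -
    have "norm (\<omega> ^ n) = norm (b / norm b)"
      using that by (auto simp: Z_def)
    also have "\<dots> = 1"
      using \<open>b \<noteq> 0\<close> by (simp add: norm_divide)
    finally show ?thesis
      using \<phi>(1) power_eq_1_iff[of "norm \<omega>" n] by (simp add: norm_power)
  qed
  have nz: "b / norm b \<noteq> 0"
    using \<open>b \<noteq> 0\<close> by simp
  have fin: "finite {\<omega>. \<omega> ^ n = c}" if "c \<noteq> 0" for c :: complex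
    using finite_nth_roots[of n c] \<phi>(1) by simp
  have card1: "card {\<omega>. \<omega> ^ n = c} = n" if "c \<noteq> 0" for c :: complex
    using card_nth_roots[of c n] that \<phi>(1) by simp
  have neg_nz: "- (b / norm b) \<noteq> 0"
    using nz by (metis neg_equal_0_iff_equal)
  have neg_ne: "b / norm b \<noteq> - (b / norm b)"
    using nz unfolding eq_neg_iff_add_eq_0 mult_2[symmetric] by simp
  have "{\<omega>. \<omega> ^ n = b / norm b} \<inter> {\<omega>. \<omega> ^ n = - (b / norm b)} = {}"
    using neg_ne by (intro equals0I) (elim IntE CollectE, metis)
  then have "card Z = n + n"
    unfolding Z_def by (metis card_Un_disjoint fin[OF nz] fin[OF neg_nz] card1[OF nz] card1[OF neg_nz])
  then have card: "card Z \<ge> 4"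
    using \<phi>(1) by simp
  define \<gamma> where "\<gamma> \<omega> t = \<psi> (of_real t * \<omega>)" for \<omega> and t :: real
  have arg_in: "of_real t * \<omega> \<in> cball 0 \<rho>" if "\<omega> \<in> Z" "0 \<le> t" "t \<le> \<rho>" for \<omega> t
    using norm1[OF that(1)] that(2,3) by (simp add: norm_mult)
  have \<gamma>_in: "\<gamma> \<omega> t \<in> S" if "\<omega> \<in> Z" "0 \<le> t" "t \<le> \<rho>" for \<omega> t
    using \<psi>_in(1)[OF arg_in[OF that]] sub unfolding \<gamma>_def by auto
  have \<gamma>_Re: "Re (F (\<gamma> \<omega> t)) = Re (F \<xi>)" if "\<omega> \<in> Z" "0 \<le> t" "t \<le> \<rho>" for \<omega> t
  proof -
    have "F (\<gamma> \<omega> t) = F \<xi> + a * (of_real t * \<omega>) ^ n"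
      using \<phi>(7)[of "\<gamma> \<omega> t"] \<psi>_in[OF arg_in[OF that]] s(2) unfolding \<gamma>_def by auto
    also have "\<dots> = F \<xi> + of_real (t ^ n) * (a * \<omega> ^ n)"
      by (simp add: power_mult_distrib)
    finally have F_eq: "F (\<gamma> \<omega> t) = F \<xi> + of_real (t ^ n) * (a * \<omega> ^ n)" .
    have "Re (of_real s * x) = s * Re x" for s x
      by simp
    then show ?thesis
      unfolding F_eq plus_complex.sel using Re0[OF that(1)] by (metis add.right_neutral mult_zero_right)
  qed
  have \<gamma>_ne: "\<gamma> \<omega> t \<noteq> \<gamma> \<omega>' t'"
    if "\<omega> \<in> Z" "0 < t" "t \<le> \<rho>" "\<omega>' \<in> Z" "0 \<le> t'" "t' \<le> \<rho>" "\<omega> \<noteq> \<omega>' \<or> t' = 0" for \<omega> \<omega>' t t'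
  proof
    assume same: "\<gamma> \<omega> t = \<gamma> \<omega>' t'"
    have "of_real t * \<omega> = \<phi> (\<gamma> \<omega> t)" "of_real t' * \<omega>' = \<phi> (\<gamma> \<omega>' t')"
      unfolding \<gamma>_def using that(2) \<psi>_in(2)[OF arg_in[OF that(1) _ that(3)]]
        \<psi>_in(2)[OF arg_in[OF that(4-6)]] by simp_all
    then have eq: "of_real t * \<omega> = of_real t' * \<omega>'"
      using same by metis
    have "t = norm (of_real t * \<omega>)" "t' = norm (of_real t' * \<omega>')"
      using that(2,5) norm1[OF that(1)] norm1[OF that(4)] by (simp_all add: norm_mult)
    then have "t = t'"
      using eq by metis
    then show False
      using eq that(2,7) by auto
  qed
  have \<gamma>_cont: "continuous_on {0..\<rho>} (\<lambda>t. v (\<gamma> \<omega> t))" if "\<omega> \<in> Z" for \<omega>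
  proof -
    have "continuous_on {0..\<rho>} (\<lambda>t. \<psi> (of_real t * \<omega>))"
      by (rule continuous_on_compose2[OF holomorphic_on_imp_continuous_on[OF \<psi>(1)]])
         (use arg_in[OF that] \<rho>(2) in \<open>auto intro!: continuous_intros\<close>)
    then have "continuous_on {0..\<rho>} (\<gamma> \<omega>)"
      by (simp add: \<gamma>_def[abs_def])
    then show ?thesis
      by (rule continuous_on_compose2[OF cont]) (use \<gamma>_in[OF that] in auto)
  qed
  have \<gamma>_0: "\<gamma> \<omega> 0 = \<xi>" for \<omega>
    using \<psi>(2)[of \<xi>] s(1) \<phi>(5) by (simp add: \<gamma>_def)
  define side where "side \<omega> \<longleftrightarrow> v \<xi> < v (\<gamma> \<omega> \<rho>)" for \<omega>
  have "card (side ` Z) \<le> card (UNIV :: bool set)"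
    by (rule card_mono) auto
  then have "\<not> inj_on side Z"
    using pigeonhole[of side Z] card by simp
  then obtain \<omega>1 \<omega>2 where \<omega>: "\<omega>1 \<in> Z" "\<omega>2 \<in> Z" "\<omega>1 \<noteq> \<omega>2" "side \<omega>1 = side \<omega>2"
    unfolding inj_on_def by blast
  show ?thesis
  proof (cases "v (\<gamma> \<omega>1 \<rho>) = v \<xi> \<or> v (\<gamma> \<omega>2 \<rho>) = v \<xi>")
    case True
    then obtain \<omega> where "\<omega> \<in> Z" "v (\<gamma> \<omega> \<rho>) = v \<xi>"
      using \<omega> by blast
    then show ?thesis
      using \<gamma>_ne[of \<omega> \<rho> \<omega> 0] \<gamma>_in[of \<omega> \<rho>] \<gamma>_Re[of \<omega> \<rho>] \<gamma>_0[of \<omega>] \<rho>(1) S(2)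
      by (intro bexI[of _ "\<gamma> \<omega> \<rho>"] bexI[of _ \<xi>]) simp_all
  next
    case False
    have hit: "\<exists>t\<in>{0..\<rho>}. v (\<gamma> \<beta> t) = v (\<gamma> \<alpha> \<rho>)"
      if "\<beta> \<in> Z" "v \<xi> \<le> v (\<gamma> \<alpha> \<rho>) \<and> v (\<gamma> \<alpha> \<rho>) \<le> v (\<gamma> \<beta> \<rho>) \<or>
          v (\<gamma> \<beta> \<rho>) \<le> v (\<gamma> \<alpha> \<rho>) \<and> v (\<gamma> \<alpha> \<rho>) \<le> v \<xi>" for \<alpha> \<beta>
      using that(2) IVT'[of "\<lambda>t. v (\<gamma> \<beta> t)" 0 "v (\<gamma> \<alpha> \<rho>)" \<rho>] IVT2'[of "\<lambda>t. v (\<gamma> \<beta> t)" \<rho> "v (\<gamma> \<alpha> \<rho>)" 0]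
        \<gamma>_cont[OF that(1)] \<gamma>_0[of \<beta>] \<rho>(1) by fastforce
    have "\<exists>\<alpha>\<in>Z. \<exists>\<beta>\<in>Z. \<alpha> \<noteq> \<beta> \<and> (v \<xi> \<le> v (\<gamma> \<alpha> \<rho>) \<and> v (\<gamma> \<alpha> \<rho>) \<le> v (\<gamma> \<beta> \<rho>) \<or>
          v (\<gamma> \<beta> \<rho>) \<le> v (\<gamma> \<alpha> \<rho>) \<and> v (\<gamma> \<alpha> \<rho>) \<le> v \<xi>)"
    proof (cases "v (\<gamma> \<omega>1 \<rho>) \<le> v (\<gamma> \<omega>2 \<rho>)")
      case True
      then show ?thesis
        using \<omega> bexI[of _ \<omega>1 Z] bexI[of _ \<omega>2 Z] unfolding side_def
        by (smt (verit, ccfv_SIG))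
    next
      case False
      then show ?thesis
        using \<omega> unfolding side_def by (smt (verit, ccfv_SIG))
    qed
    then obtain \<alpha> \<beta> where \<alpha>\<beta>: "\<alpha> \<in> Z" "\<beta> \<in> Z" "\<alpha> \<noteq> \<beta>"
        "v \<xi> \<le> v (\<gamma> \<alpha> \<rho>) \<and> v (\<gamma> \<alpha> \<rho>) \<le> v (\<gamma> \<beta> \<rho>) \<or> v (\<gamma> \<beta> \<rho>) \<le> v (\<gamma> \<alpha> \<rho>) \<and> v (\<gamma> \<alpha> \<rho>) \<le> v \<xi>"
      by blast
    obtain t where t: "t \<in> {0..\<rho>}" "v (\<gamma> \<beta> t) = v (\<gamma> \<alpha> \<rho>)"
      using hit[OF \<alpha>\<beta>(2,4)] by blast
    show ?thesis
      using \<gamma>_ne[of \<alpha> \<rho> \<beta> t] \<gamma>_in[of \<alpha> \<rho>] \<gamma>_Re[of \<alpha> \<rho>] \<gamma>_in[of \<beta> t] \<gamma>_Re[of \<beta> t] \<alpha>\<beta> t \<rho>(1)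
      by (intro bexI[of _ "\<gamma> \<alpha> \<rho>"] bexI[of _ "\<gamma> \<beta> t"]) simp_all
  qed
qed

text \<open>
  If \<open>\<bar>h'\<bar> = \<bar>g'\<bar>\<close> at \<open>z\<close>, a rotation \<open>c\<close> makes \<open>Re (c f) = Re (c h + cnj c g)\<close> critical at \<open>z\<close>, so the
  preceding lemma applies to it with \<open>v = Im (c f)\<close> and contradicts the injectivity of \<open>f\<close>.
\<close>

lemma Lewy_jacobian_nonzero:
  assumes f: "canonical_rep f h g" and inj: "locally_univalent_on f unit_disc"
    and z: "z \<in> unit_disc"
  shows "jacobian h g z \<noteq> 0"
proof
  assume "jacobian h g z = 0"
  then have norm_eq: "norm (deriv h z) = norm (deriv g z)"
    unfolding jacobian_def using power2_eq_iff_nonneg by fastforce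
  obtain U where U: "open U" "z \<in> U" "U \<subseteq> unit_disc" "inj_on f U"
    using inj z unfolding locally_univalent_on_def by blast
  have hol: "h holomorphic_on U" "g holomorphic_on U" and f_eq: "\<And>w. w \<in> U \<Longrightarrow> f w = h w + cnj (g w)"
    using f U(3) unfolding canonical_rep_def by (auto intro: holomorphic_on_subset)
  have "\<exists>c. norm c = 1 \<and> c * deriv h z + cnj c * deriv g z = 0"
  proof (cases "deriv h z = 0")
    case True
    then show ?thesis
      using norm_eq by (intro exI[of _ 1]) auto
  next
    case False
    \<comment> \<open>For \<open>\<bar>c\<bar> = 1\<close> the equation reads \<open>c\<^sup>2 h' + g' = 0\<close>.\<close>
    define c where "c = csqrt (- deriv g z / deriv h z)"
    have sq: "c\<^sup>2 = - deriv g z / deriv h z"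
      by (simp add: c_def)
    have "(norm c)\<^sup>2 = 1"
      using sq norm_eq False by (metis norm_power norm_divide norm_minus_cancel divide_self norm_eq_zero)
    then have c: "norm c = 1"
      using power2_eq_1_iff[of "norm c"] norm_ge_zero[of c] by linarith
    have "cnj c * c = 1"
      using c complex_norm_square[of c] by (simp add: mult.commute)
    then have "c * deriv h z + cnj c * deriv g z = cnj c * (c\<^sup>2 * deriv h z + deriv g z)"
      by (simp add: power2_eq_square algebra_simps)
    also have "\<dots> = 0"
      using sq False by simp
    finally show ?thesis
      using c by blast
  qed
  then obtain c where c: "norm c = 1" "c * deriv h z + cnj c * deriv g z = 0"
    by blast
  define F where "F w = c * h w + cnj c * g w" for w
  have "F holomorphic_on U"
    unfolding F_def[abs_def] using hol by (intro holomorphic_intros)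
  moreover have "deriv F z = 0"
  proof (rule DERIV_imp_deriv)
    show "(F has_field_derivative 0) (at z)"
      unfolding F_def[abs_def]
      using holomorphic_derivI[OF hol(1) U(1,2)] holomorphic_derivI[OF hol(2) U(1,2)] c(2)
      by (auto intro!: derivative_eq_intros simp: mult.commute)
  qed
  moreover have "continuous_on U f"
    by (subst continuous_on_cong[OF refl f_eq], assumption)
       (intro continuous_intros holomorphic_on_imp_continuous_on hol)
  then have "continuous_on U (\<lambda>w. Im (c * f w))"
    by (intro continuous_intros)
  ultimately obtain x y where xy: "x \<in> U" "y \<in> U" "x \<noteq> y" "Re (F x) = Re (F y)"
      "Im (c * f x) = Im (c * f y)"
    using critical_level_set_not_injected[of F U z "\<lambda>w. Im (c * f w)"] U by blast
  have "Re (c * f w) = Re (F w)" if "w \<in> U" for w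
    using f_eq[OF that] by (simp add: F_def algebra_simps)
  then have "c * f x = c * f y"
    using xy by (simp add: complex_eq_iff)
  then have "f x = f y"
    using c(1) by auto
  then show False
    using U(4) xy by (auto dest: inj_onD)
qed

lemma sense_preserving_cases:
  assumes f: "canonical_rep f h g" and inj: "locally_univalent_on f unit_disc"
  shows "sense_preserving h g \<or> sense_preserving g h"
proof -
  have hol: "deriv h holomorphic_on unit_disc" "deriv g holomorphic_on unit_disc"
    using f unfolding canonical_rep_def by (auto intro: holomorphic_deriv)
  have cont: "continuous_on unit_disc (jacobian h g)"
    unfolding jacobian_def[abs_def]
    by (intro continuous_intros holomorphic_on_imp_continuous_on hol)
  have "connected (jacobian h g ` unit_disc)"
    by (intro connected_continuous_image cont) simp
  then have conn: "is_interval (jacobian h g ` unit_disc)"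
    by (simp add: is_interval_connected_1)
  have nz: "jacobian h g z \<noteq> 0" if "z \<in> unit_disc" for z
    by (rule Lewy_jacobian_nonzero[OF f inj that])
  have "(\<forall>z\<in>unit_disc. jacobian h g z > 0) \<or> (\<forall>z\<in>unit_disc. jacobian h g z < 0)"
  proof (rule ccontr)
    assume "\<not> ?thesis"
    then obtain x y where xy: "x \<in> unit_disc" "y \<in> unit_disc" "jacobian h g x \<le> 0" "0 \<le> jacobian h g y"
      by (meson not_less)
    then have "0 \<in> jacobian h g ` unit_disc"
      using conn unfolding is_interval_1 by blast
    then show False
      using nz by auto
  qed
  then show ?thesis
    by (auto simp: sense_preserving_def jacobian_def)
qed

section \<open>Riccati inequalities on the disc\<close>

text \<open>
  Rotate so that \<open>q t = \<omega> p (\<xi> + t \<omega>)\<close> starts at the positive number \<open>A\<close>. The exact solution of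
  \<open>q' = q\<^sup>2/2\<close> with this initial value is \<open>A / (1 - A t / 2)\<close>, which reaches \<open>2 A\<close> at
  \<open>t = 1 / A\<close>, against the assumed bound \<open>4/3 A\<close>; only a large error \<open>E\<close> can prevent this. The
  deviation is measured by \<open>\<phi> = q (1 - A t / 2) - A\<close>, since \<open>\<phi>' = q \<phi> / 2\<close> up to the error: it is
  linear in \<open>\<phi>\<close>, and on an interval of length \<open>1 / A\<close> its coefficient \<open>\<bar>q / 2\<bar> \<le> 2/3 A\<close> is small
  enough for the mean value inequality to absorb \<open>\<phi>\<close>.
\<close>

lemma riccati_blow_up:
  fixes p :: "complex \<Rightarrow> complex" and L :: "complex \<Rightarrow> complex \<Rightarrow> complex"
  assumes A: "norm (p \<xi>) = A" "A > 0"
    and der: "\<And>z. z \<in> cball \<xi> (1 / A) \<Longrightarrow> (p has_derivative L z) (at z)"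
    and ric: "\<And>z v. z \<in> cball \<xi> (1 / A) \<Longrightarrow> norm (L z v - (p z)\<^sup>2 / 2 * v) \<le> E * norm v"
    and bound: "\<And>z. z \<in> cball \<xi> (1 / A) \<Longrightarrow> norm (p z) \<le> 4 / 3 * A"
  shows "A\<^sup>2 \<le> 9 * E"
proof -
  define \<omega> where "\<omega> = of_real A / p \<xi>"
  have \<omega>: "norm \<omega> = 1" "\<omega> * p \<xi> = of_real A"
    using A by (auto simp: \<omega>_def norm_divide)
  define z where "z t = \<xi> + t *\<^sub>R \<omega>" for t :: real
  have z_in: "z t \<in> cball \<xi> (1 / A)" if "t \<in> {0..1 / A}" for t
    using that \<omega>(1) by (simp add: z_def dist_norm)
  define q where "q t = \<omega> * p (z t)" for t
  define l where "l t = complex_of_real (1 - A * t / 2)" for t :: real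
  define \<phi> where "\<phi> t = q t * l t - of_real A" for t
  define \<phi>' where "\<phi>' t = \<omega> * L (z t) \<omega> * l t - q t * of_real (A / 2)" for t
  have q_der: "(q has_vector_derivative \<omega> * L (z t) \<omega>) (at t)" if "t \<in> {0..1 / A}" for t
  proof -
    have "(z has_derivative (\<lambda>h. h *\<^sub>R \<omega>)) (at t)"
      unfolding z_def[abs_def] by (auto intro!: derivative_eq_intros)
    then have "((\<lambda>t. p (z t)) has_derivative (\<lambda>h. L (z t) (h *\<^sub>R \<omega>))) (at t)"
      by (rule has_derivative_compose) (rule der[OF z_in[OF that]])
    then have "((\<lambda>t. p (z t)) has_vector_derivative L (z t) \<omega>) (at t)"
      unfolding has_vector_derivative_def
      using linear_scale[OF has_derivative_linear[OF der[OF z_in[OF that]]]] by simp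
    then show ?thesis
      unfolding q_def[abs_def] by (rule has_vector_derivative_mult_right)
  qed
  have l_der: "(l has_vector_derivative of_real (- A / 2)) (at t)" for t
    unfolding l_def[abs_def]
    by (rule has_vector_derivative_of_real) (auto intro!: derivative_eq_intros)
  have \<phi>_der: "(\<phi> has_vector_derivative \<phi>' t) (at t)" if "t \<in> {0..1 / A}" for t
    unfolding \<phi>_def[abs_def] \<phi>'_def
    by (rule has_vector_derivative_eq_rhs,
        rule has_vector_derivative_diff[OF has_vector_derivative_mult[OF q_der[OF that] l_der] has_vector_derivative_const])
       (simp add: algebra_simps)
  have "continuous_on {0..1 / A} \<phi>"
    by (rule continuous_on_vector_derivative[OF has_vector_derivative_at_within[OF \<phi>_der]])
  then have cont: "continuous_on {0..1 / A} (\<lambda>t. norm (\<phi> t))"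
    by (rule continuous_on_norm)
  obtain s where s: "s \<in> {0..1 / A}" "\<And>t. t \<in> {0..1 / A} \<Longrightarrow> norm (\<phi> t) \<le> norm (\<phi> s)"
    using continuous_attains_sup[OF _ _ cont] A(2) by auto
  define m where "m = norm (\<phi> s)"
  have \<phi>'_bound: "norm (\<phi>' t) \<le> 2 / 3 * A * m + E" if t: "t \<in> {0..1 / A}" for t
  proof -
    have E: "norm (L (z t) \<omega> - (p (z t))\<^sup>2 / 2 * \<omega>) \<le> E"
      using ric[OF z_in[OF t], of \<omega>] \<omega>(1) by simp
    have "A * t \<le> 1" "0 \<le> A * t"
      using t A(2) by (auto simp: field_simps)
    then have l: "norm (l t) \<le> 1"
      unfolding l_def norm_of_real by linarith
    have "norm (q t) \<le> 4 / 3 * A"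
      using bound[OF z_in[OF t]] \<omega>(1) by (simp add: q_def norm_mult)
    then have "norm (q t / 2 * \<phi> t) \<le> (2 / 3 * A) * m"
      unfolding norm_mult norm_divide m_def using s(2)[OF t] A(2) by (intro mult_mono) auto
    moreover have "norm (\<omega> * (L (z t) \<omega> - (p (z t))\<^sup>2 / 2 * \<omega>) * l t) \<le> E * 1"
      unfolding norm_mult[of _ "l t"] using E l \<omega>(1)
      by (intro mult_mono) (auto simp: norm_mult intro: order_trans[OF norm_ge_zero])
    moreover have "\<phi>' t = q t / 2 * \<phi> t + \<omega> * (L (z t) \<omega> - (p (z t))\<^sup>2 / 2 * \<omega>) * l t"
      unfolding \<phi>'_def \<phi>_def q_def by (simp add: algebra_simps power2_eq_square)
    ultimately show ?thesis
      by (simp only: mult_1_right) (rule norm_triangle_mono)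
  qed
  have \<phi>0: "\<phi> 0 = 0"
    using \<omega>(2) by (simp add: \<phi>_def q_def z_def l_def)
  have "norm (\<phi> s - \<phi> 0) \<le> (2 / 3 * A * m + E) * norm (s - 0)"
  proof (rule differentiable_bound[of "{0..1 / A}"])
    show "(\<phi> has_derivative (\<lambda>h. h *\<^sub>R \<phi>' t)) (at t within {0..1 / A})" if "t \<in> {0..1 / A}" for t
      using has_vector_derivative_at_within[OF \<phi>_der[OF that]] by (simp add: has_vector_derivative_def)
    show "onorm (\<lambda>h. h *\<^sub>R \<phi>' t) \<le> 2 / 3 * A * m + E" if "t \<in> {0..1 / A}" for t
      by (rule onorm_le) (use mult_left_mono[OF \<phi>'_bound[OF that] abs_ge_zero] in \<open>simp add: mult.commute\<close>)
  qed (use s A in auto)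
  moreover have "(2 / 3 * A * m + E) * norm (s - 0) \<le> (2 / 3 * A * m + E) * (1 / A)"
    using s(1) order_trans[OF norm_ge_zero \<phi>'_bound[OF s(1)]] by (intro mult_left_mono) auto
  ultimately have "m \<le> (2 / 3 * A * m + E) * (1 / A)"
    unfolding \<phi>0 m_def by simp
  also have "\<dots> = 2 / 3 * m + E / A"
    using A(2) by (simp add: field_simps)
  finally have m: "m \<le> 3 * (E / A)"
    by simp
  have end_in: "1 / A \<in> {0..1 / A}"
    using A(2) by simp
  have "l (1 / A) = 1 / 2"
    using A(2) by (simp add: l_def)
  then have "of_real A = q (1 / A) / 2 - \<phi> (1 / A)"
    by (simp add: \<phi>_def)
  then have "A \<le> norm (q (1 / A) / 2) + norm (\<phi> (1 / A))"
    using norm_triangle_ineq4[of "q (1 / A) / 2" "\<phi> (1 / A)"] A(2)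
    by (metis norm_of_real abs_of_pos)
  moreover have "norm (q (1 / A) / 2) \<le> 2 / 3 * A"
    using bound[OF z_in[OF end_in]] \<omega>(1) by (simp add: q_def norm_mult norm_divide)
  ultimately have "A / 3 \<le> 3 * (E / A)"
    using s(2)[OF end_in] m A(2) unfolding m_def by simp
  then show ?thesis
    using A(2) by (simp add: field_simps power2_eq_square)
qed

text \<open>
  On a smaller disc of radius \<open>R\<close> the quantity \<open>\<bar>p w\<bar> (R - \<bar>w\<bar>)\<close> has a maximum, at \<open>\<xi>\<close> say. If the
  maximum exceeds \<open>4\<close>, then \<open>R - \<bar>w\<bar>\<close> drops by at most a quarter on the disc of radius
  \<open>1 / \<bar>p \<xi>\<bar>\<close> about \<open>\<xi>\<close>, so maximality gives \<open>\<bar>p\<bar> \<le> 4/3 \<bar>p \<xi>\<bar>\<close> there, which is what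
  \<open>riccati_blow_up\<close> needs. The resulting bound is independent of \<open>R\<close>.
\<close>

lemma riccati_disc_bound:
  fixes p :: "complex \<Rightarrow> complex" and L :: "complex \<Rightarrow> complex \<Rightarrow> complex"
  assumes der: "\<And>z. z \<in> ball 0 1 \<Longrightarrow> (p has_derivative L z) (at z)"
    and ric: "\<And>z v. z \<in> ball 0 1 \<Longrightarrow>
      norm (L z v - (p z)\<^sup>2 / 2 * v) \<le> C / (1 - norm z)\<^sup>2 * norm v"
    and z: "z \<in> ball 0 1"
  shows "norm (p z) * (1 - norm z) \<le> 4 + 4 * sqrt C"
proof -
  have C: "C \<ge> 0"
    using order_trans[OF norm_ge_zero ric[of 0 1]] by simp
  have cont: "continuous_on (ball 0 1) p"
    by (intro continuous_at_imp_continuous_on ballI has_derivative_continuous[OF der])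
  have main: "norm (p z) * (R - norm z) \<le> 4 + 4 * sqrt C" if R: "norm z < R" "R < 1" for R
  proof -
    have sub: "cball 0 R \<subseteq> ball (0 :: complex) 1"
      using R by auto
    have "continuous_on (cball 0 R) (\<lambda>w. norm (p w) * (R - norm w))"
      by (intro continuous_intros continuous_on_subset[OF cont sub])
    moreover have "cball (0::complex) R \<noteq> {}"
      using order_trans[OF norm_ge_zero[of z] less_imp_le[OF R(1)]] by auto
    ultimately obtain \<xi> where \<xi>: "\<xi> \<in> cball 0 R"
        "\<And>w. w \<in> cball 0 R \<Longrightarrow> norm (p w) * (R - norm w) \<le> norm (p \<xi>) * (R - norm \<xi>)"
      using continuous_attains_sup[OF compact_cball, of 0 R "\<lambda>w. norm (p w) * (R - norm w)"] by blast
    define A d where "A = norm (p \<xi>)" and "d = R - norm \<xi>"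
    have "A * d \<le> 4 + 4 * sqrt C"
    proof (rule ccontr)
      assume "\<not> ?thesis"
      then have big: "A * d > 4" "A * d > 4 * sqrt C"
        using real_sqrt_ge_zero[OF C] by linarith+
      have nonneg: "A \<ge> 0" "d \<ge> 0"
        using \<xi>(1) by (auto simp: A_def d_def)
      then have pos: "A > 0" "d > 0"
        using big(1) by (auto simp: less_le)
      have "1 / A \<le> d / 4"
        using big(1) pos by (simp add: field_simps)
      then have room: "3 / 4 * d \<le> R - norm w" if "w \<in> cball \<xi> (1 / A)" for w
        using that norm_triangle_ineq2[of w \<xi>] unfolding d_def by (simp add: dist_norm norm_minus_commute)
      have in_R: "w \<in> cball 0 R" if "w \<in> cball \<xi> (1 / A)" for w
        using room[OF that] pos by simp
      have "A\<^sup>2 \<le> 9 * (C / (3 / 4 * d)\<^sup>2)"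
      proof (rule riccati_blow_up[of p \<xi>])
        fix w assume w: "w \<in> cball \<xi> (1 / A)"
        show "(p has_derivative L w) (at w)"
          using der in_R[OF w] sub by blast
        have "C / (1 - norm w)\<^sup>2 \<le> C / (3 / 4 * d)\<^sup>2"
          using room[OF w] R(2) pos C by (intro divide_left_mono power_mono mult_pos_pos) auto
        moreover have "norm (L w v - (p w)\<^sup>2 / 2 * v) \<le> C / (1 - norm w)\<^sup>2 * norm v" for v
          using ric in_R[OF w] sub by blast
        ultimately show "norm (L w v - (p w)\<^sup>2 / 2 * v) \<le> C / (3 / 4 * d)\<^sup>2 * norm v" for v
          by (meson mult_right_mono norm_ge_zero order_trans)
        have "norm (p w) * (3 / 4 * d) \<le> norm (p w) * (R - norm w)"
          using room[OF w] by (intro mult_left_mono) auto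
        also have "\<dots> \<le> A * d"
          using \<xi>(2)[OF in_R[OF w]] by (simp add: A_def d_def)
        finally show "norm (p w) \<le> 4 / 3 * A"
          using pos by (simp add: field_simps)
      qed (use pos in \<open>auto simp: A_def\<close>)
      then have "(A * d)\<^sup>2 \<le> 16 * C"
        using pos by (simp add: field_simps power2_eq_square)
      then have "A * d \<le> sqrt (16 * C)"
        by (rule real_le_rsqrt)
      also have "\<dots> = 4 * sqrt C"
        by (simp add: real_sqrt_mult)
      finally show False
        using big(2) by simp
    qed
    then show ?thesis
      using \<xi>(2)[of z] R unfolding A_def d_def by simp
  qed
  have "((\<lambda>R. norm (p z) * (R - norm z)) \<longlongrightarrow> norm (p z) * (1 - norm z)) (at_left 1)"
    by (intro tendsto_intros)
  moreover have "eventually (\<lambda>R. norm (p z) * (R - norm z) \<le> 4 + 4 * sqrt C) (at_left 1)"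
    using eventually_at_left_real[of "norm z" 1] z main by (auto elim!: eventually_mono)
  ultimately show ?thesis
    by (rule tendsto_upperbound) simp
qed

section \<open>Derivatives of self-maps of the disc\<close>

lemma Cauchy_bound_into_disc:
  assumes w: "w holomorphic_on ball 0 1" "\<And>\<zeta>. \<zeta> \<in> ball 0 1 \<Longrightarrow> norm (w \<zeta>) < 1"
    and z: "z \<in> ball 0 1"
  shows "norm ((deriv ^^ n) w z) \<le> fact n / ((1 - norm z) / 2) ^ n"
proof -
  have sub: "cball z ((1 - norm z) / 2) \<subseteq> ball 0 1"
  proof
    fix \<zeta> assume "\<zeta> \<in> cball z ((1 - norm z) / 2)"
    then have "norm (\<zeta> - z) \<le> (1 - norm z) / 2"
      by (simp add: dist_norm norm_minus_commute)
    moreover have "norm z < 1"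
      using z by simp
    ultimately have "norm \<zeta> < 1"
      using norm_triangle_ineq2[of \<zeta> z] by (simp add: field_simps)
    then show "\<zeta> \<in> ball 0 1"
      by simp
  qed
  have "norm ((deriv ^^ n) w z) \<le> fact n * 1 / ((1 - norm z) / 2) ^ n"
  proof (rule Cauchy_inequality)
    show "w holomorphic_on ball z ((1 - norm z) / 2)"
      using w(1) sub ball_subset_cball holomorphic_on_subset by blast
    show "continuous_on (cball z ((1 - norm z) / 2)) w"
      using w(1) sub holomorphic_on_imp_continuous_on holomorphic_on_subset by blast
    show "norm (w x) \<le> 1" if "norm (z - x) = (1 - norm z) / 2" for x
      using w(2)[of x] sub that by (force simp: dist_norm)
  qed (use z in auto)
  then show ?thesis
    by simp
qed

text \<open>
  Composing \<open>w\<close> with the disc automorphism that takes \<open>w z\<close> to \<open>0\<close> gives a map \<open>W\<close> of the disc into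
  itself, to which Cauchy's estimates apply; the factor \<open>1 - \<bar>w z\<bar>\<^sup>2\<close> appears when its derivatives
  at \<open>z\<close> are expressed by those of \<open>w\<close>. The constants are not sharp: only the order of growth matters.
\<close>

lemma schwarz_pick_derivatives:
  assumes w: "w holomorphic_on ball 0 1" "\<And>\<zeta>. \<zeta> \<in> ball 0 1 \<Longrightarrow> norm (w \<zeta>) < 1"
    and z: "z \<in> ball 0 1"
  shows "norm (deriv w z) \<le> 2 * (1 - (norm (w z))\<^sup>2) / (1 - norm z)"
    and "norm (deriv (deriv w) z) \<le> 16 * (1 - (norm (w z))\<^sup>2) / (1 - norm z)\<^sup>2"
proof -
  define a where "a = w z"
  define d where "d = 1 - (norm a)\<^sup>2"
  have a: "norm a < 1"
    using w(2)[OF z] by (simp add: a_def)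
  have d_pos: "d > 0"
    unfolding d_def using power_less_one_iff[of "norm a" 2] a by simp
  have d_eq: "complex_of_real d = 1 - cnj a * a"
    unfolding d_def using complex_norm_square[of a] by (simp add: mult.commute)
  define D where "D \<zeta> = 1 - cnj a * w \<zeta>" for \<zeta>
  have D_nz: "D \<zeta> \<noteq> 0" if "\<zeta> \<in> ball 0 1" for \<zeta>
  proof
    assume "D \<zeta> = 0"
    then have "norm (cnj a * w \<zeta>) = 1"
      by (simp add: D_def)
    moreover have "norm a * norm (w \<zeta>) \<le> norm a * 1"
      using w(2)[OF that] by (intro mult_left_mono) auto
    ultimately show False
      using a by (simp add: norm_mult)
  qed
  define W where "W \<zeta> = Moebius_function 0 a (w \<zeta>)" for \<zeta>
  have W_eq: "W \<zeta> = (w \<zeta> - a) / D \<zeta>" for \<zeta>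
    by (simp add: W_def D_def Moebius_function_def)
  have W_less: "norm (W \<zeta>) < 1" if "\<zeta> \<in> ball 0 1" for \<zeta>
    unfolding W_def using Moebius_function_norm_lt_1[OF a w(2)[OF that]] .
  have W_hol: "W holomorphic_on ball 0 1"
    unfolding W_eq[abs_def] using D_nz unfolding D_def by (intro holomorphic_intros w(1)) auto
  have w_der: "(w has_field_derivative deriv w \<zeta>) (at \<zeta>)" if "\<zeta> \<in> ball 0 1" for \<zeta>
    using holomorphic_derivI[OF w(1) open_ball that] .
  have D_der: "(D has_field_derivative - cnj a * deriv w \<zeta>) (at \<zeta>)" if "\<zeta> \<in> ball 0 1" for \<zeta>
    unfolding D_def[abs_def] using w_der[OF that] by (auto intro!: derivative_eq_intros)
  have W_deriv: "deriv W \<zeta> = of_real d * deriv w \<zeta> / (D \<zeta>)\<^sup>2" if "\<zeta> \<in> ball 0 1" for \<zeta>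
  proof (rule DERIV_imp_deriv)
    have "(W has_field_derivative
        (deriv w \<zeta> * D \<zeta> - (w \<zeta> - a) * (- cnj a * deriv w \<zeta>)) / (D \<zeta> * D \<zeta>)) (at \<zeta>)"
      unfolding W_eq[abs_def] using D_nz[OF that] D_der[OF that] w_der[OF that]
      by (auto intro!: derivative_eq_intros)
    also have "deriv w \<zeta> * D \<zeta> - (w \<zeta> - a) * (- cnj a * deriv w \<zeta>) = of_real d * deriv w \<zeta>"
      unfolding d_eq D_def by (simp add: algebra_simps)
    finally show "(W has_field_derivative of_real d * deriv w \<zeta> / (D \<zeta>)\<^sup>2) (at \<zeta>)"
      by (simp add: power2_eq_square)
  qed
  have Dz: "D z = of_real d"
    by (simp add: D_def d_eq a_def)
  have w': "deriv w z = of_real d * deriv W z"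
    using W_deriv[OF z] d_pos by (simp add: Dz power2_eq_square)
  have w'': "deriv (deriv w) z = of_real d * (deriv (deriv W) z - 2 * cnj a * (deriv W z)\<^sup>2)"
  proof -
    have "((\<lambda>\<zeta>. of_real d * deriv w \<zeta> / (D \<zeta>)\<^sup>2) has_field_derivative
        of_real d * (deriv (deriv w) z / (D z)\<^sup>2 + 2 * cnj a * (deriv w z)\<^sup>2 / (D z) ^ 3)) (at z)"
      using D_nz[OF z] D_der[OF z] holomorphic_derivI[OF holomorphic_deriv[OF w(1) open_ball] open_ball z]
      by (auto intro!: derivative_eq_intros simp: field_simps power2_eq_square power3_eq_cube)
    then have "(deriv W has_field_derivative
        of_real d * (deriv (deriv w) z / (D z)\<^sup>2 + 2 * cnj a * (deriv w z)\<^sup>2 / (D z) ^ 3)) (at z)"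
      by (rule has_field_derivative_transform_within_open[OF _ open_ball z]) (simp add: W_deriv)
    then have "deriv (deriv W) z =
        of_real d * (deriv (deriv w) z / (D z)\<^sup>2 + 2 * cnj a * (deriv w z)\<^sup>2 / (D z) ^ 3)"
      by (rule DERIV_imp_deriv)
    also have "\<dots> = deriv (deriv w) z / of_real d + 2 * cnj a * (deriv W z)\<^sup>2"
      unfolding w' Dz using d_pos by (simp add: field_simps power2_eq_square power3_eq_cube)
    finally show ?thesis
      using d_pos by simp
  qed
  define e where "e = 1 - norm z"
  have e: "e > 0"
    using z by (simp add: e_def)
  have W1: "norm (deriv W z) \<le> 2 / e" and W2: "norm (deriv (deriv W) z) \<le> 8 / e\<^sup>2"
    using Cauchy_bound_into_disc[OF W_hol W_less z, of 1] Cauchy_bound_into_disc[OF W_hol W_less z, of 2]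
    by (simp_all add: e_def numeral_2_eq_2 power2_eq_square)
  have "norm (deriv w z) = d * norm (deriv W z)"
    using d_pos by (simp add: w' norm_mult)
  also have "\<dots> \<le> d * (2 / e)"
    using W1 d_pos by (intro mult_left_mono) auto
  finally show "norm (deriv w z) \<le> 2 * (1 - (norm (w z))\<^sup>2) / (1 - norm z)"
    by (simp add: d_def a_def e_def mult.commute)
  have "norm (2 * cnj a * (deriv W z)\<^sup>2) \<le> 2 * 1 * (2 / e)\<^sup>2"
    unfolding norm_mult norm_power using a W1 by (intro mult_mono power_mono) auto
  then have "norm (deriv (deriv W) z - 2 * cnj a * (deriv W z)\<^sup>2) \<le> 8 / e\<^sup>2 + 2 * 1 * (2 / e)\<^sup>2"
    using W2 norm_triangle_ineq4 order_trans add_mono by (metis (no_types, lifting))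
  also have "\<dots> = 16 / e\<^sup>2"
    by (simp add: power2_eq_square)
  finally have "d * norm (deriv (deriv W) z - 2 * cnj a * (deriv W z)\<^sup>2) \<le> d * (16 / e\<^sup>2)"
    using d_pos by (intro mult_left_mono) auto
  moreover have "norm (deriv (deriv w) z) = d * norm (deriv (deriv W) z - 2 * cnj a * (deriv W z)\<^sup>2)"
    unfolding w'' norm_mult[of "of_real d"] norm_of_real using d_pos by simp
  ultimately show "norm (deriv (deriv w) z) \<le> 16 * (1 - (norm (w z))\<^sup>2) / (1 - norm z)\<^sup>2"
    by (simp add: d_def a_def e_def mult.commute)
qed

section \<open>Pre-Schwarzian and Schwarzian derivatives\<close>

lemma disc_weight_bounds:
  assumes "z \<in> ball (0 :: complex) 1"
  shows "(1 - norm z)\<^sup>2 \<le> (1 - (norm z)\<^sup>2)\<^sup>2" "(1 - (norm z)\<^sup>2)\<^sup>2 \<le> 4 * (1 - norm z)\<^sup>2"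
proof -
  have z: "0 \<le> norm z" "norm z < 1"
    using assms by auto
  have eq: "(1 - (norm z)\<^sup>2)\<^sup>2 = (1 + norm z)\<^sup>2 * (1 - norm z)\<^sup>2"
    by (simp add: power2_eq_square algebra_simps)
  have "1 \<le> (1 + norm z)\<^sup>2" "(1 + norm z)\<^sup>2 \<le> 2\<^sup>2"
    using z power_mono[of "1 + norm z" 2 2] by simp_all
  then have "1 * (1 - norm z)\<^sup>2 \<le> (1 + norm z)\<^sup>2 * (1 - norm z)\<^sup>2"
      "(1 + norm z)\<^sup>2 * (1 - norm z)\<^sup>2 \<le> 2\<^sup>2 * (1 - norm z)\<^sup>2"
    by (intro mult_right_mono; simp)+
  then show "(1 - norm z)\<^sup>2 \<le> (1 - (norm z)\<^sup>2)\<^sup>2" "(1 - (norm z)\<^sup>2)\<^sup>2 \<le> 4 * (1 - norm z)\<^sup>2"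
    unfolding eq by simp_all
qed

text \<open>
  The weight \<open>1 - \<bar>z\<bar>\<close> is comparable to \<open>1 - \<bar>z\<bar>\<^sup>2\<close> and, being the distance to the boundary, is the
  one that the Riccati and Cauchy estimates produce.
\<close>

lemma schwarzian_norm_finite_iff:
  "schwarzian_norm S < \<infinity> \<longleftrightarrow> (\<exists>B. \<forall>z\<in>unit_disc. norm (S z) \<le> B / (1 - norm z)\<^sup>2)"
proof
  assume fin: "schwarzian_norm S < \<infinity>"
  then obtain r where r: "r \<ge> 0" "schwarzian_norm S = ennreal r"
    by (cases "schwarzian_norm S") auto
  show "\<exists>B. \<forall>z\<in>unit_disc. norm (S z) \<le> B / (1 - norm z)\<^sup>2"
  proof (intro exI ballI)
    fix z :: complex assume z: "z \<in> unit_disc"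
    have "ennreal (norm (S z) * (1 - (norm z)\<^sup>2)\<^sup>2) \<le> ennreal r"
      unfolding r(2)[symmetric] schwarzian_norm_def using z by (rule SUP_upper)
    then have "norm (S z) * (1 - (norm z)\<^sup>2)\<^sup>2 \<le> r"
      using r(1) by simp
    moreover have "norm (S z) * (1 - norm z)\<^sup>2 \<le> norm (S z) * (1 - (norm z)\<^sup>2)\<^sup>2"
      using disc_weight_bounds(1)[OF z] by (intro mult_left_mono) auto
    ultimately have "norm (S z) * (1 - norm z)\<^sup>2 \<le> r"
      by linarith
    then show "norm (S z) \<le> r / (1 - norm z)\<^sup>2"
      using z by (simp add: pos_le_divide_eq)
  qed
next
  assume "\<exists>B. \<forall>z\<in>unit_disc. norm (S z) \<le> B / (1 - norm z)\<^sup>2"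
  then obtain B where B: "\<And>z. z \<in> unit_disc \<Longrightarrow> norm (S z) \<le> B / (1 - norm z)\<^sup>2"
    by blast
  have "schwarzian_norm S \<le> ennreal (4 * B)"
    unfolding schwarzian_norm_def
  proof (intro SUP_least ennreal_leI)
    fix z :: complex assume z: "z \<in> unit_disc"
    have "norm (S z) * (1 - (norm z)\<^sup>2)\<^sup>2 \<le> norm (S z) * (4 * (1 - norm z)\<^sup>2)"
      using disc_weight_bounds(2)[OF z] by (intro mult_left_mono) auto
    also have "\<dots> \<le> B / (1 - norm z)\<^sup>2 * (4 * (1 - norm z)\<^sup>2)"
      using B[OF z] by (intro mult_right_mono) auto
    also have "\<dots> = 4 * B"
      using z by simp
    finally show "norm (S z) * (1 - (norm z)\<^sup>2)\<^sup>2 \<le> 4 * B" .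
  qed
  then show "schwarzian_norm S < \<infinity>"
    using ennreal_less_top order_le_less_trans by (metis infinity_ennreal_def)
qed

text \<open>
  The function differentiated here is \<open>- \<partial>/\<partial>z log (1 - \<bar>w\<bar>\<^sup>2)\<close> when \<open>w'\<close> is the derivative of \<open>w\<close>. The
  coefficients of \<open>v\<close> and \<open>cnj v\<close> are its derivatives with respect to \<open>z\<close> and \<open>cnj z\<close>.
\<close>

lemma log_jacobian_derivative_correction:
  assumes w: "(w has_field_derivative w' z) (at z)" and w': "(w' has_field_derivative w2) (at z)"
    and d: "d = 1 - w z * cnj (w z)" "d \<noteq> 0"
  shows "((\<lambda>\<zeta>. w' \<zeta> * cnj (w \<zeta>) / (1 - w \<zeta> * cnj (w \<zeta>))) has_derivative
      (\<lambda>v. (w2 * cnj (w z) / d + (w' z * cnj (w z) / d)\<^sup>2) * v + w' z * cnj (w' z) / d\<^sup>2 * cnj v)) (at z)"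
proof -
  have D: "(w has_derivative (*) (w' z)) (at z)" "(w' has_derivative (*) w2) (at z)"
    using w w' by (simp_all add: has_field_derivative_def)
  show ?thesis
    by (rule has_derivative_eq_rhs, (rule derivative_intros D)+)
       (use d(2) in \<open>auto simp: fun_eq_iff field_simps power2_eq_square d(1)[symmetric]\<close>,
        simp add: d(1) algebra_simps)
qed

locale sense_preserving_harmonic =
  fixes h g :: "complex \<Rightarrow> complex"
  assumes h_hol: "h holomorphic_on unit_disc" and g_hol: "g holomorphic_on unit_disc"
    and sp: "sense_preserving h g"
begin

text \<open>
  \<open>H\<close> is the pre-Schwarzian derivative of \<open>h\<close>, and \<open>H - k\<close> is the pre-Schwarzian derivative
  \<open>(log J)\<^sub>z\<close> of the harmonic mapping, because \<open>J = \<bar>h'\<bar>\<^sup>2 (1 - \<bar>w\<bar>\<^sup>2)\<close>.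
\<close>

definition "w = dilatation h g"
definition "H z = deriv (deriv h) z / deriv h z"
definition "d z = complex_of_real (1 - (norm (w z))\<^sup>2)"
definition "k z = deriv w z * cnj (w z) / d z"

lemma deriv_h_nonzero: "z \<in> unit_disc \<Longrightarrow> deriv h z \<noteq> 0"
  using sp by (force simp: sense_preserving_def jacobian_def)

lemma w_hol: "w holomorphic_on unit_disc"
  unfolding w_def dilatation_def[abs_def]
  by (intro holomorphic_intros holomorphic_deriv h_hol g_hol open_ball deriv_h_nonzero)

lemma H_hol: "H holomorphic_on unit_disc"
  unfolding H_def[abs_def]
  by (intro holomorphic_intros holomorphic_deriv h_hol open_ball deriv_h_nonzero)

lemma w_less_1: "norm (w z) < 1" if "z \<in> unit_disc"
proof -
  have "(norm (deriv g z))\<^sup>2 < (norm (deriv h z))\<^sup>2"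
    using sp that by (simp add: sense_preserving_def jacobian_def)
  then have "norm (deriv g z) < norm (deriv h z)"
    by (rule power_less_imp_less_base) simp
  then show ?thesis
    using deriv_h_nonzero[OF that] by (simp add: w_def dilatation_def norm_divide)
qed

lemma d_pos: "1 - (norm (w z))\<^sup>2 > 0" if "z \<in> unit_disc"
  using w_less_1[OF that] power_less_one_iff[of "norm (w z)" 2] by simp

lemma norm_d: "norm (d z) = 1 - (norm (w z))\<^sup>2" if "z \<in> unit_disc"
  unfolding d_def norm_of_real using d_pos[OF that] by simp

lemma d_eq: "d z = 1 - w z * cnj (w z)"
  unfolding d_def using complex_norm_square[of "w z"] by simp

lemma schwarzian_eq: "schwarzian h z = deriv H z - (H z)\<^sup>2 / 2"
  by (simp add: schwarzian_def H_def[abs_def])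

lemma harmonic_schwarzian_eq:
  "sp_harmonic_schwarzian h g z = schwarzian h z
     + (H z * k z - cnj (w z) / d z * deriv (deriv w) z) - 3/2 * (k z)\<^sup>2"
  unfolding sp_harmonic_schwarzian_def Let_def w_def[symmetric] d_def[symmetric] H_def[symmetric] k_def
  by (simp add: algebra_simps)

lemma norm_deriv_w_div_d: "norm (deriv w z / d z) \<le> 2 / (1 - norm z)" if z: "z \<in> unit_disc"
  using schwarz_pick_derivatives(1)[OF w_hol w_less_1 z] d_pos[OF z] z
  unfolding norm_divide norm_d[OF z] by (simp add: field_simps)

lemma norm_k: "norm (k z) \<le> 2 / (1 - norm z)" if z: "z \<in> unit_disc"
proof -
  have "norm (k z) = norm (deriv w z / d z) * norm (w z)"
    by (simp add: k_def norm_mult norm_divide)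
  also have "\<dots> \<le> 2 / (1 - norm z) * 1"
    using norm_deriv_w_div_d[OF z] w_less_1[OF z] z by (intro mult_mono) auto
  finally show ?thesis
    by simp
qed

lemma norm_deriv2_w_term: "norm (cnj (w z) / d z * deriv (deriv w) z) \<le> 16 / (1 - norm z)\<^sup>2"
  if z: "z \<in> unit_disc"
proof -
  have "norm (deriv (deriv w) z / d z) \<le> 16 / (1 - norm z)\<^sup>2"
    using schwarz_pick_derivatives(2)[OF w_hol w_less_1 z] d_pos[OF z] z
    unfolding norm_divide norm_d[OF z] by (simp add: field_simps)
  moreover have "norm (cnj (w z) / d z * deriv (deriv w) z) = norm (w z) * norm (deriv (deriv w) z / d z)"
    by (simp add: norm_mult norm_divide)
  moreover have "norm (w z) * norm (deriv (deriv w) z / d z) \<le> 1 * norm (deriv (deriv w) z / d z)"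
    using w_less_1[OF z] by (intro mult_right_mono) auto
  ultimately show ?thesis
    by linarith
qed

text \<open>
  This is why only the size of the pre-Schwarzian derivative matters: all remaining terms of the
  difference are controlled by the dilatation, that is, by a self-map of the disc.
\<close>

lemma schwarzian_difference_bound:
  assumes z: "z \<in> unit_disc" and H: "norm (H z) \<le> K / (1 - norm z)"
  shows "norm (sp_harmonic_schwarzian h g z - schwarzian h z) \<le> (2 * K + 22) / (1 - norm z)\<^sup>2"
proof -
  define e where "e = 1 - norm z"
  have e: "e > 0"
    using z by (simp add: e_def)
  note k = norm_k[OF z, folded e_def] and H = H[folded e_def]
  have "norm (H z * k z) \<le> (K / e) * (2 / e)"
    unfolding norm_mult using k H by (intro mult_mono) (auto intro: order_trans[OF norm_ge_zero])
  moreover have "norm (3/2 * (k z)\<^sup>2) \<le> 3/2 * (2 / e)\<^sup>2"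
    unfolding norm_mult norm_power using k by (intro mult_mono power_mono) auto
  moreover have "norm (H z * k z - cnj (w z) / d z * deriv (deriv w) z - 3/2 * (k z)\<^sup>2)
      \<le> norm (H z * k z) + norm (cnj (w z) / d z * deriv (deriv w) z) + norm (3/2 * (k z)\<^sup>2)"
    by (intro order_trans[OF norm_triangle_ineq4] add_right_mono norm_triangle_ineq4)
  moreover have diff: "sp_harmonic_schwarzian h g z - schwarzian h z
      = H z * k z - cnj (w z) / d z * deriv (deriv w) z - 3/2 * (k z)\<^sup>2"
    by (simp add: harmonic_schwarzian_eq)
  moreover have "(K / e) * (2 / e) + 16 / e\<^sup>2 + 3/2 * (2 / e)\<^sup>2 = (2 * K + 22) / e\<^sup>2"
    using e by (simp add: field_simps power2_eq_square)
  ultimately show ?thesis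
    using norm_deriv2_w_term[OF z] unfolding diff e_def by linarith
qed

lemma H_bound_of_schwarzian_bound:
  assumes S: "\<And>z. z \<in> unit_disc \<Longrightarrow> norm (schwarzian h z) \<le> B / (1 - norm z)\<^sup>2"
    and z: "z \<in> unit_disc"
  shows "norm (H z) \<le> (4 + 4 * sqrt B) / (1 - norm z)"
proof -
  have "norm (H z) * (1 - norm z) \<le> 4 + 4 * sqrt B"
  proof (rule riccati_disc_bound[of H "\<lambda>z v. deriv H z * v"])
    show "(H has_derivative (\<lambda>v. deriv H \<zeta> * v)) (at \<zeta>)" if "\<zeta> \<in> ball 0 1" for \<zeta>
      using holomorphic_derivI[OF H_hol open_ball that] by (simp add: has_field_derivative_def)
    show "norm (deriv H \<zeta> * v - (H \<zeta>)\<^sup>2 / 2 * v) \<le> B / (1 - norm \<zeta>)\<^sup>2 * norm v"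
      if "\<zeta> \<in> ball 0 1" for \<zeta> v
    proof -
      have "deriv H \<zeta> * v - (H \<zeta>)\<^sup>2 / 2 * v = schwarzian h \<zeta> * v"
        by (simp add: schwarzian_eq algebra_simps)
      then show ?thesis
        using mult_right_mono[OF S[OF that] norm_ge_zero[of v]] by (simp add: norm_mult)
    qed
  qed (rule z)
  then show ?thesis
    using z by (simp add: pos_le_divide_eq)
qed

text \<open>
  The Riccati estimate is applied to \<open>(log J)\<^sub>z\<close>, whose \<open>z\<close>-derivative minus half its square is the
  harmonic Schwarzian. Its \<open>cnj z\<close>-derivative \<open>- m\<close> joins the error term, since \<open>\<bar>m\<bar>\<close> is the square
  of the quantity \<open>\<bar>w'\<bar> / (1 - \<bar>w\<bar>\<^sup>2)\<close> bounded by \<open>norm_deriv_w_div_d\<close>.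
\<close>

lemma H_bound_of_harmonic_schwarzian_bound:
  assumes S: "\<And>z. z \<in> unit_disc \<Longrightarrow> norm (sp_harmonic_schwarzian h g z) \<le> B / (1 - norm z)\<^sup>2"
    and z: "z \<in> unit_disc"
  shows "norm (H z) \<le> (6 + 4 * sqrt (B + 4)) / (1 - norm z)"
proof -
  define p where "p z = H z - k z" for z
  define m where "m z = deriv w z * cnj (deriv w z) / (d z)\<^sup>2" for z
  define L where "L z v = (sp_harmonic_schwarzian h g z + (p z)\<^sup>2 / 2) * v - m z * cnj v" for z v
  have "norm (p z) * (1 - norm z) \<le> 4 + 4 * sqrt (B + 4)"
  proof (rule riccati_disc_bound[of p L])
    fix \<zeta> :: complex assume \<zeta>: "\<zeta> \<in> ball 0 1"
    have d_nz: "d \<zeta> \<noteq> 0"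
      using norm_d[OF \<zeta>] d_pos[OF \<zeta>] by auto
    have "(k has_derivative (\<lambda>v. (deriv (deriv w) \<zeta> * cnj (w \<zeta>) / d \<zeta> + (k \<zeta>)\<^sup>2) * v + m \<zeta> * cnj v)) (at \<zeta>)"
      unfolding k_def[abs_def] m_def
      using log_jacobian_derivative_correction[OF holomorphic_derivI[OF w_hol open_ball \<zeta>]
          holomorphic_derivI[OF holomorphic_deriv[OF w_hol open_ball] open_ball \<zeta>] d_eq d_nz]
      by (simp add: d_eq)
    moreover have "(H has_derivative (\<lambda>v. deriv H \<zeta> * v)) (at \<zeta>)"
      using holomorphic_derivI[OF H_hol open_ball \<zeta>] by (simp add: has_field_derivative_def)
    ultimately have "(p has_derivative (\<lambda>v. deriv H \<zeta> * v -
        ((deriv (deriv w) \<zeta> * cnj (w \<zeta>) / d \<zeta> + (k \<zeta>)\<^sup>2) * v + m \<zeta> * cnj v))) (at \<zeta>)"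
      unfolding p_def[abs_def] by (rule has_derivative_diff[rotated])
    moreover have "deriv H \<zeta> * v - ((deriv (deriv w) \<zeta> * cnj (w \<zeta>) / d \<zeta> + (k \<zeta>)\<^sup>2) * v + m \<zeta> * cnj v)
        = L \<zeta> v" for v
      unfolding L_def harmonic_schwarzian_eq schwarzian_eq p_def
      by (simp add: algebra_simps power2_eq_square add_divide_distrib diff_divide_distrib)
    ultimately show "(p has_derivative L \<zeta>) (at \<zeta>)"
      by (simp add: fun_eq_iff)
    show "norm (L \<zeta> v - (p \<zeta>)\<^sup>2 / 2 * v) \<le> (B + 4) / (1 - norm \<zeta>)\<^sup>2 * norm v" for v
    proof -
      have "norm (m \<zeta>) = (norm (deriv w \<zeta> / d \<zeta>))\<^sup>2"
        by (simp add: m_def norm_mult norm_divide norm_power power2_eq_square)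
      also have "\<dots> \<le> (2 / (1 - norm \<zeta>))\<^sup>2"
        using norm_deriv_w_div_d[OF \<zeta>] by (intro power_mono) auto
      finally have m: "norm (m \<zeta>) \<le> 4 / (1 - norm \<zeta>)\<^sup>2"
        by (simp add: power_divide)
      have "L \<zeta> v - (p \<zeta>)\<^sup>2 / 2 * v = sp_harmonic_schwarzian h g \<zeta> * v - m \<zeta> * cnj v"
        by (simp add: L_def algebra_simps)
      also have "norm \<dots> \<le> norm (sp_harmonic_schwarzian h g \<zeta>) * norm v + norm (m \<zeta>) * norm v"
        by (rule order_trans[OF norm_triangle_ineq4]) (simp add: norm_mult)
      also have "\<dots> \<le> B / (1 - norm \<zeta>)\<^sup>2 * norm v + 4 / (1 - norm \<zeta>)\<^sup>2 * norm v"
        using S[OF \<zeta>] m by (intro add_mono mult_right_mono) auto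
      finally show ?thesis
        by (simp add: add_divide_distrib algebra_simps)
    qed
  qed (rule z)
  moreover have "norm (k z) * (1 - norm z) \<le> 2"
    using norm_k[OF z] z by (simp add: pos_le_divide_eq)
  moreover have "norm (H z) * (1 - norm z) \<le> (norm (p z) + norm (k z)) * (1 - norm z)"
    using norm_triangle_ineq[of "p z" "k z"] z unfolding p_def by (intro mult_right_mono) auto
  ultimately have "norm (H z) * (1 - norm z) \<le> 6 + 4 * sqrt (B + 4)"
    by (simp add: algebra_simps)
  then show ?thesis
    using z by (simp add: pos_le_divide_eq)
qed

lemma schwarzian_norm_finite_iff_harmonic:
  "schwarzian_norm (sp_harmonic_schwarzian h g) < \<infinity> \<longleftrightarrow> schwarzian_norm (schwarzian h) < \<infinity>"
proof -
  have transfer: "norm b \<le> (B + K) / r" if "norm a \<le> B / r" "norm (a - b) \<le> K / r" for a b :: complex and B K r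
    using that norm_triangle_sub[of b a] by (simp add: add_divide_distrib norm_minus_commute)
  show ?thesis
    unfolding schwarzian_norm_finite_iff
  proof (intro iffI; elim exE)
    fix B assume B: "\<forall>z\<in>unit_disc. norm (sp_harmonic_schwarzian h g z) \<le> B / (1 - norm z)\<^sup>2"
    then have "norm (schwarzian h z) \<le> (B + (2 * (6 + 4 * sqrt (B + 4)) + 22)) / (1 - norm z)\<^sup>2"
      if "z \<in> unit_disc" for z
      using transfer[OF _ schwarzian_difference_bound[OF that H_bound_of_harmonic_schwarzian_bound]] that
      by blast
    then show "\<exists>B. \<forall>z\<in>unit_disc. norm (schwarzian h z) \<le> B / (1 - norm z)\<^sup>2"
      by blast
  next
    fix B assume B: "\<forall>z\<in>unit_disc. norm (schwarzian h z) \<le> B / (1 - norm z)\<^sup>2"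
    then have "norm (sp_harmonic_schwarzian h g z) \<le> (B + (2 * (4 + 4 * sqrt B) + 22)) / (1 - norm z)\<^sup>2"
      if "z \<in> unit_disc" for z
      using transfer[of "schwarzian h z" B _ "sp_harmonic_schwarzian h g z"]
        schwarzian_difference_bound[OF that H_bound_of_schwarzian_bound] that
      by (metis norm_minus_commute)
    then show "\<exists>B. \<forall>z\<in>unit_disc. norm (sp_harmonic_schwarzian h g z) \<le> B / (1 - norm z)\<^sup>2"
      by blast
  qed
qed

end

section \<open>Arbitrary locally univalent mappings\<close>

theorem theorem6:
  fixes f h g :: "complex \<Rightarrow> complex"
  assumes "canonical_rep f h g"
    and "locally_univalent_on f unit_disc"
  shows "schwarzian_norm (harmonic_schwarzian h g) < \<infinity> \<longleftrightarrow>
         schwarzian_norm (schwarzian (sp_analytic_part h g)) < \<infinity>"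
proof -
  have hol: "h holomorphic_on unit_disc" "g holomorphic_on unit_disc"
    using assms(1) by (auto simp: canonical_rep_def)
  show ?thesis
  proof (cases "sense_preserving h g")
    case True
    interpret sense_preserving_harmonic h g
      by unfold_locales (use hol True in auto)
    show ?thesis
      using schwarzian_norm_finite_iff_harmonic True
      by (simp add: harmonic_schwarzian_def sp_analytic_part_def)
  next
    case False
    then have "sense_preserving g h"
      using sense_preserving_cases[OF assms] by blast
    then interpret sense_preserving_harmonic g h
      by unfold_locales (use hol in auto)
    show ?thesis
      using schwarzian_norm_finite_iff_harmonic False
      by (simp add: harmonic_schwarzian_def sp_analytic_part_def)
  qed
qed

end
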